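(* Let $(A_b,A_w)$ be a pairwise comparison system, with $D_1,D_2,\epsilon_i,\epsilon_{i,j},\eta$ and $\epsilon_W$ as defined in the context, and let $\epsilon^*$ be the optimal objective value of the linear best-worst problem (P) stated in the context. Then the following statements hold. 1. If $\eta=\epsilon_{i_0}$ for some $i_0\in D_1$, then $W=\{w_1,\ldots,w_n\}$ defined by $$w_b=\frac{a_{bw}-\epsilon_{i_0}}{\sigma},\quad w_{i_0}=\frac{a_{i_0w}+\epsilon_{i_0}}{\sigma},\quad w_w=\frac{1}{\sigma},\quad w_i=\frac{\min\left\{a_{iw}+\epsilon_{i_0},\frac{a_{bw}}{a_{bi}}\right\}}{\sigma}\ \text{ for } i\in D\setminus\{i_0\},$$ where $\sigma=1+a_{bw}+a_{i_0w}+\sum_{i\in D,\, i\neq i_0}\min\left\{a_{iw}+\epsilon_{i_0},\frac{a_{bw}}{a_{bi}}\right\}$, is the optimal weight set, and consequently $\epsilon^*=\epsilon_W=\frac{\epsilon_{i_0}}{\sigma}$. 2. If $\eta=\epsilon_{j_0}$ for some $j_0\in D_2$, then $W=\{w_1,\ldots,w_n\}$ defined by $$w_b=\frac{a_{bw}+\epsilon_{j_0}}{\sigma},\quad w_{j_0}=\frac{a_{j_0w}-\epsilon_{j_0}}{\sigma},\quad w_w=\frac{1}{\sigma},\quad w_i=\frac{\min\left\{a_{iw}+\epsilon_{j_0},\frac{a_{bw}+2\epsilon_{j_0}}{a_{bi}}\right\}}{\sigma}\ \text{ for } i\in D\setminus\{j_0\},$$ where $\sigma=1+a_{bw}+a_{j_0w}+\sum_{i\in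 D,\, i\neq j_0}\min\left\{a_{iw}+\epsilon_{j_0},\frac{a_{bw}+2\epsilon_{j_0}}{a_{bi}}\right\}$, is the optimal weight set, and consequently $\epsilon^*=\epsilon_W=\frac{\epsilon_{j_0}}{\sigma}$. 3. If $\eta=\epsilon_{i_0,j_0}$ for some $i_0\in D_1$ and $j_0\in D_2$, then $W=\{w_1,\ldots,w_n\}$ defined by $$w_b=\frac{a_{bi_0}a_{i_0w}+(a_{bi_0}+1)\epsilon_{i_0,j_0}}{\sigma},\quad w_{i_0}=\frac{a_{i_0w}+\epsilon_{i_0,j_0}}{\sigma},\quad w_{j_0}=\frac{a_{j_0w}-\epsilon_{i_0,j_0}}{\sigma},\quad w_w=\frac{1}{\sigma},$$ $$w_i=\frac{\min\left\{a_{iw}+\epsilon_{i_0,j_0},\frac{a_{bi_0}a_{i_0w}+(a_{bi_0}+2)\epsilon_{i_0,j_0}}{a_{bi}}\right\}}{\sigma}\ \text{ for } i\in D\setminus\{i_0,j_0\},$$ where $\sigma=1+a_{i_0w}+a_{j_0w}+a_{bi_0}a_{i_0w}+(a_{bi_0}+1)\epsilon_{i_0,j_0}+\sum_{i\in D,\, i\neq i_0,j_0}\min\left\{a_{iw}+\epsilon_{i_0,j_0},\frac{a_{bi_0}a_{i_0w}+(a_{bi_0}+2)\epsilon_{i_0,j_0}}{a_{bi}}\right\}$, is the optimal weight set, and consequently $\epsilon^*=\epsilon_W=\frac{\epsilon_{i_0,j_0}}{\sigma}$.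
   Context: Let $C=\{1,2,\ldots,n\}$ with $n\geq 3$ index the decision criteria, let $b,w\in C$ with $b\neq w$ be the (indices of the) best and worst criteria, and let $D=C\setminus\{b,w\}$. A pairwise comparison system (PCS) is a pair $A=(A_b,A_w)$ with $A_b=(a_{b1},\ldots,a_{bn})$ and $A_w=(a_{1w},\ldots,a_{nw})^T$, where all entries are positive real numbers, $a_{bb}=a_{ww}=1$, and the entry $a_{bw}$ is common to both vectors. Define $$D_1=\{i\in D: a_{bi}a_{iw}<a_{bw}\},\quad D_2=\{i\in D: a_{bi}a_{iw}>a_{bw}\},$$ $$\epsilon_i=\frac{|a_{bi}a_{iw}-a_{bw}|}{a_{bi}+2},\quad \epsilon_{i,j}=\frac{|a_{bi}a_{iw}-a_{bj}a_{jw}|}{a_{bi}+a_{bj}+2}\quad (i,j\in D),$$ $$\eta=\max\{\epsilon_i,\epsilon_{j,k}: i\in D,\ j\in D_1,\ k\in D_2\}.$$ Let $\mathcal{W}$ be the set of all weight sets $W=\{w_1,\ldots,w_n\}$ (families indexed by $C$) with $\sum_{i=1}^n w_i=1$ and $w_i\geq 0$ for all $i\in C$. For $W\in\mathcal{W}$ let $$\epsilon_W=\max\{|w_b-a_{bi}w_i|,\ |w_i-a_{iw}w_w|,\ |w_b-a_{bw}w_w|: i\in D\}.$$ Problem (P), the linear best-worst problem: minimize $\epsilon$ subject to $|w_b-a_{bi}w_i|\leq\epsilon$, $|w_i-a_{iw}w_w|\leq\epsilon$ for all $i\in D$, $|w_b-a_{bw}w_w|\leq\epsilon$, $w_1+\cdots+w_n=1$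 and $w_j\geq 0$ for all $j\in C$. Equivalently, minimize $\epsilon_W$ over $W\in\mathcal{W}$. "The optimal weight set" means the unique $W\in\mathcal{W}$ at which the minimum is attained. *)

theory Defs
  imports Complex_Main "HOL-Library.FuncSet"
begin

text \<open>
  The comparison vectors $A_b$ and $A_w$ are functions \<open>ab\<close> and \<open>aw\<close> on the criteria \<open>{1..n}\<close>:
  \<open>ab i\<close> is $a_{bi}$ and \<open>aw i\<close> is $a_{iw}$. The common entry $a_{bw}$ is \<open>ab w\<close>, which equals \<open>aw b\<close>.
  Values of \<open>ab\<close> and \<open>aw\<close> outside \<open>{1..n}\<close> are irrelevant.
\<close>

definition pcs :: "nat \<Rightarrow> nat \<Rightarrow> nat \<Rightarrow> (nat \<Rightarrow> real) \<Rightarrow> (nat \<Rightarrow> real) \<Rightarrow> bool" where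
  "pcs n b w ab aw \<longleftrightarrow>
     n \<ge> 3 \<and> b \<in> {1..n} \<and> w \<in> {1..n} \<and> b \<noteq> w \<and>
     (\<forall>i\<in>{1..n}. ab i > 0 \<and> aw i > 0) \<and>
     ab b = 1 \<and> aw w = 1 \<and> ab w = aw b"

definition D_set :: "nat \<Rightarrow> nat \<Rightarrow> nat \<Rightarrow> nat set" where
  "D_set n b w = {1..n} - {b, w}"

definition D1 :: "nat \<Rightarrow> nat \<Rightarrow> nat \<Rightarrow> (nat \<Rightarrow> real) \<Rightarrow> (nat \<Rightarrow> real) \<Rightarrow> nat set" where
  "D1 n b w ab aw = {i \<in> D_set n b w. ab i * aw i < ab w}"

definition D2 :: "nat \<Rightarrow> nat \<Rightarrow> nat \<Rightarrow> (nat \<Rightarrow> real) \<Rightarrow> (nat \<Rightarrow> real) \<Rightarrow> nat set" where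
  "D2 n b w ab aw = {i \<in> D_set n b w. ab i * aw i > ab w}"

definition eps1 :: "nat \<Rightarrow> (nat \<Rightarrow> real) \<Rightarrow> (nat \<Rightarrow> real) \<Rightarrow> nat \<Rightarrow> real" where
  "eps1 w ab aw i = \<bar>ab i * aw i - ab w\<bar> / (ab i + 2)"

definition eps2 :: "(nat \<Rightarrow> real) \<Rightarrow> (nat \<Rightarrow> real) \<Rightarrow> nat \<Rightarrow> nat \<Rightarrow> real" where
  "eps2 ab aw i j = \<bar>ab i * aw i - ab j * aw j\<bar> / (ab i + ab j + 2)"

definition eta :: "nat \<Rightarrow> nat \<Rightarrow> nat \<Rightarrow> (nat \<Rightarrow> real) \<Rightarrow> (nat \<Rightarrow> real) \<Rightarrow> real" where
  "eta n b w ab aw =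
     Max ({eps1 w ab aw i | i. i \<in> D_set n b w} \<union>
          {eps2 ab aw j k | j k. j \<in> D1 n b w ab aw \<and> k \<in> D2 n b w ab aw})"

text \<open>
  Weight sets are families indexed by exactly \<open>{1..n}\<close>, represented by extensional functions, so that
  equality of functions is equality of families.
\<close>

definition weight_sets :: "nat \<Rightarrow> (nat \<Rightarrow> real) set" where
  "weight_sets n = {W \<in> {1..n} \<rightarrow>\<^sub>E UNIV. (\<Sum>i\<in>{1..n}. W i) = 1 \<and> (\<forall>i\<in>{1..n}. W i \<ge> 0)}"

definition eps_W ::
  "nat \<Rightarrow> nat \<Rightarrow> nat \<Rightarrow> (nat \<Rightarrow> real) \<Rightarrow> (nat \<Rightarrow> real) \<Rightarrow> (nat \<Rightarrow> real) \<Rightarrow> real" where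
  "eps_W n b w ab aw W =
     Max ({\<bar>W b - ab i * W i\<bar> | i. i \<in> D_set n b w} \<union>
          {\<bar>W i - aw i * W w\<bar> | i. i \<in> D_set n b w} \<union>
          {\<bar>W b - ab w * W w\<bar>})"

definition feasible ::
  "nat \<Rightarrow> nat \<Rightarrow> nat \<Rightarrow> (nat \<Rightarrow> real) \<Rightarrow> (nat \<Rightarrow> real) \<Rightarrow> (nat \<Rightarrow> real) \<Rightarrow> real \<Rightarrow> bool" where
  "feasible n b w ab aw W \<epsilon> \<longleftrightarrow>
     W \<in> weight_sets n \<and>
     (\<forall>i\<in>D_set n b w. \<bar>W b - ab i * W i\<bar> \<le> \<epsilon> \<and> \<bar>W i - aw i * W w\<bar> \<le> \<epsilon>) \<and>
     \<bar>W b - ab w * W w\<bar> \<le> \<epsilon>"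

definition optimal_value ::
  "nat \<Rightarrow> nat \<Rightarrow> nat \<Rightarrow> (nat \<Rightarrow> real) \<Rightarrow> (nat \<Rightarrow> real) \<Rightarrow> real" where
  "optimal_value n b w ab aw = Inf {\<epsilon>. \<exists>W. feasible n b w ab aw W \<epsilon>}"

definition is_minimizer ::
  "nat \<Rightarrow> nat \<Rightarrow> nat \<Rightarrow> (nat \<Rightarrow> real) \<Rightarrow> (nat \<Rightarrow> real) \<Rightarrow> (nat \<Rightarrow> real) \<Rightarrow> bool" where
  "is_minimizer n b w ab aw W \<longleftrightarrow>
     W \<in> weight_sets n \<and> (\<forall>V\<in>weight_sets n. eps_W n b w ab aw W \<le> eps_W n b w ab aw V)"

definition is_the_optimal_weight_set ::
  "nat \<Rightarrow> nat \<Rightarrow> nat \<Rightarrow> (nat \<Rightarrow> real) \<Rightarrow> (nat \<Rightarrow> real) \<Rightarrow> (nat \<Rightarrow> real) \<Rightarrow> bool" where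
  "is_the_optimal_weight_set n b w ab aw W \<longleftrightarrow>
     is_minimizer n b w ab aw W \<and> (\<forall>V. is_minimizer n b w ab aw V \<longrightarrow> V = W)"

end

theory Submission imports Defs begin

text \<open>
  Suppose that the weights \<open>V\<close> have error at most \<open>\<delta>\<close>. For every \<open>i \<in> D\<close>, the two constraints on the
  criterion \<open>i\<close> combine to confine \<open>V b\<close> to an interval with centre \<open>ab i * aw i * V w\<close> and radius
  \<open>(ab i + 1) * \<delta>\<close>; the remaining constraint confines it to the interval with centre \<open>ab w * V w\<close> and
  radius \<open>\<delta>\<close>. Normalise \<open>V w = 1\<close>. Two of these intervals meet exactly if \<open>\<delta>\<close> is at least the
  distance of their centres divided by the sum of their radii, and $\epsilon_i$ and $\epsilon_{i,j}$ are
  such ratios. The ratios that occur in the definition of $\eta$ decide whether all pairs meet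
  (\<open>intervals_meet\<close>), and finitely many intervals on a line that meet pairwise have a common point.
  Thus $\eta$ is the least normalised error for which all the intervals meet, and for that error two
  of them, say those of \<open>k\<close> and \<open>l\<close>, touch in a single point \<open>\<beta>\<close>. The three cases of the
  theorem tell which intervals touch: in case 1 the upper end of the one of $i_0$ and the lower end
  of the one of \<open>w\<close>, in case 2 the upper end of \<open>w\<close> and the lower end of $j_0$, in case 3 the upper end
  of $i_0$ and the lower end of $j_0$.

  Normalising \<open>V w = 1\<close> is not the normalisation of the problem, which is \<open>\<Sum>V = 1\<close>. The two are
  reconciled by an upper bound. Let \<open>X\<close> have \<open>X w = 1\<close>, \<open>X b = \<beta>\<close>, and each remaining \<open>X i\<close> as large as
  the error $\eta$ permits. Weights \<open>V\<close> of error \<open>\<delta>\<close> satisfy \<open>V i \<le> (\<delta> / \<eta>) * X i\<close> for every \<open>i\<close>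
  (\<open>scaled_bound\<close>), because every upper bound on \<open>V i\<close> is increasing and homogeneous in \<open>(V w, \<delta>)\<close> and the
  touching intervals force \<open>V w \<le> \<delta> / \<eta>\<close>. Summing over \<open>i\<close> gives \<open>1 \<le> (\<delta> / \<eta>) * \<sigma>\<close> with \<open>\<sigma> = \<Sum>X\<close>, that is,
  \<open>\<delta> \<ge> \<eta> / \<sigma>\<close>. In case of equality \<open>V\<close> lies below \<open>X / \<sigma>\<close> and has the same sum, so \<open>V = X / \<sigma>\<close>. As \<open>X\<close> meets
  all constraints with error $\eta$ (\<open>extremal_constraints\<close>), \<open>X / \<sigma>\<close> attains the bound.
\<close>

section \<open>The error of a weight set\<close>

lemma finite_D_set [simp]: "finite (D_set n b w)"
  by (simp add: D_set_def)

lemma eps_W_le_iff: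
  "eps_W n b w ab aw W \<le> \<epsilon> \<longleftrightarrow>
     (\<forall>i\<in>D_set n b w. \<bar>W b - ab i * W i\<bar> \<le> \<epsilon> \<and> \<bar>W i - aw i * W w\<bar> \<le> \<epsilon>) \<and>
     \<bar>W b - ab w * W w\<bar> \<le> \<epsilon>"
  unfolding eps_W_def by (subst Max_le_iff) auto

lemma feasible_iff_eps_W_le:
  "feasible n b w ab aw W \<epsilon> \<longleftrightarrow> W \<in> weight_sets n \<and> eps_W n b w ab aw W \<le> \<epsilon>"
  by (simp add: feasible_def eps_W_le_iff)

lemma optimal_value_eq_eps_W:
  assumes "is_minimizer n b w ab aw W"
  shows "optimal_value n b w ab aw = eps_W n b w ab aw W"
  unfolding optimal_value_def feasible_iff_eps_W_le
proof (rule cInf_eq_minimum)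
  show "eps_W n b w ab aw W \<in> {\<epsilon>. \<exists>V. V \<in> weight_sets n \<and> eps_W n b w ab aw V \<le> \<epsilon>}"
    using assms by (auto simp: is_minimizer_def)
  fix \<epsilon> assume "\<epsilon> \<in> {\<epsilon>. \<exists>V. V \<in> weight_sets n \<and> eps_W n b w ab aw V \<le> \<epsilon>}"
  then show "eps_W n b w ab aw W \<le> \<epsilon>"
    using assms unfolding is_minimizer_def by (blast dest: order_trans)
qed

section \<open>The intervals for the weight of the best criterion\<close>

locale best_worst =
  fixes n b w :: nat and ab aw :: "nat \<Rightarrow> real"
  assumes pcs: "pcs n b w ab aw"
begin

abbreviation "D \<equiv> D_set n b w"

lemma ab_pos: "i \<in> {1..n} \<Longrightarrow> ab i > 0" and aw_pos: "i \<in> {1..n} \<Longrightarrow> aw i > 0"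
  and aw_w [simp]: "aw w = 1" and b_in: "b \<in> {1..n}" and w_in: "w \<in> {1..n}" and b_neq_w: "b \<noteq> w"
  using pcs by (auto simp: pcs_def)

lemma D_pos: "i \<in> D \<Longrightarrow> ab i > 0" "i \<in> D \<Longrightarrow> aw i > 0"
  by (auto simp: D_set_def ab_pos aw_pos)

lemma D_neq: "i \<in> D \<Longrightarrow> i \<noteq> b" "i \<in> D \<Longrightarrow> i \<noteq> w"
  by (auto simp: D_set_def)

text \<open>
  The interval of \<open>w\<close> is the one of the constraint that compares \<open>b\<close> with \<open>w\<close> directly. It has centre
  \<open>ab w * aw w = ab w\<close>, as for the criteria in \<open>D\<close>, but a smaller radius because it comes from a single
  constraint.
\<close>

definition centre :: "nat \<Rightarrow> real" where
  "centre i = ab i * aw i"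

definition radius :: "nat \<Rightarrow> real" where
  "radius i = (if i = w then 1 else ab i + 1)"

lemma centre_w [simp]: "centre w = ab w" and radius_w [simp]: "radius w = 1"
  by (simp_all add: centre_def radius_def)

lemma centre_pos: "i \<in> insert w D \<Longrightarrow> centre i > 0"
  using w_in by (auto simp: centre_def D_pos ab_pos)

lemma radius_D: "i \<in> D \<Longrightarrow> radius i = ab i + 1"
  by (simp add: radius_def D_neq)

lemma radius_ge_1: "i \<in> insert w D \<Longrightarrow> radius i \<ge> 1"
  using D_pos by (force simp: radius_def)

text \<open>The radius is \<open>ab i + 1\<close> because the error in \<open>V i\<close> is multiplied by \<open>ab i\<close> when it is passed on to \<open>V b\<close>.\<close>

lemma best_weight_in_interval:
  assumes err: "eps_W n b w ab aw V \<le> \<delta>" and i: "i \<in> insert w D"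
  shows "\<bar>V b - centre i * V w\<bar> \<le> radius i * \<delta>"
proof (cases "i = w")
  case True
  then show ?thesis using err by (simp add: eps_W_le_iff)
next
  case False
  with i have iD: "i \<in> D" by simp
  have "\<bar>V b - centre i * V w\<bar> = \<bar>(V b - ab i * V i) + ab i * (V i - aw i * V w)\<bar>"
    by (simp add: centre_def algebra_simps)
  also have "\<dots> \<le> \<bar>V b - ab i * V i\<bar> + ab i * \<bar>V i - aw i * V w\<bar>"
    using D_pos(1)[OF iD] by (metis abs_mult abs_of_pos abs_triangle_ineq)
  also have "\<dots> \<le> \<delta> + ab i * \<delta>"
    using err iD D_pos(1)[OF iD] by (intro add_mono mult_left_mono) (auto simp: eps_W_le_iff)
  finally show ?thesis using iD by (simp add: radius_D algebra_simps)
qed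

lemma eta_ge:
  shows eps1_le_eta: "i \<in> D \<Longrightarrow> eps1 w ab aw i \<le> eta n b w ab aw"
    and eps2_le_eta: "j \<in> D1 n b w ab aw \<Longrightarrow> k \<in> D2 n b w ab aw \<Longrightarrow> eps2 ab aw j k \<le> eta n b w ab aw"
proof -
  have "finite (D1 n b w ab aw)" "finite (D2 n b w ab aw)"
    by (simp_all add: D1_def D2_def)
  then have fin: "finite ({eps1 w ab aw i | i. i \<in> D} \<union>
      {eps2 ab aw j k | j k. j \<in> D1 n b w ab aw \<and> k \<in> D2 n b w ab aw})"
    by (auto intro: finite_image_set2)
  show "i \<in> D \<Longrightarrow> eps1 w ab aw i \<le> eta n b w ab aw"
    and "j \<in> D1 n b w ab aw \<Longrightarrow> k \<in> D2 n b w ab aw \<Longrightarrow> eps2 ab aw j k \<le> eta n b w ab aw"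
    unfolding eta_def by (rule Max_ge[OF fin]; blast)+
qed

text \<open>
  The quantities $\epsilon_i$ and $\epsilon_{i,j}$ are the errors at which two intervals begin to touch:
  distance of the centres divided by the sum of the radii.
\<close>

lemma eps1_mult:
  assumes "i \<in> D"
  shows "eps1 w ab aw i * (radius i + radius w) = \<bar>centre i - centre w\<bar>"
  using D_pos(1)[OF assms] by (simp add: eps1_def centre_def radius_D assms add.commute)

lemma eps2_mult:
  assumes "i \<in> D" "j \<in> D"
  shows "eps2 ab aw i j * (radius i + radius j) = \<bar>centre i - centre j\<bar>"
proof -
  have "radius i + radius j = ab i + ab j + 2" "ab i + ab j + 2 \<noteq> 0"
    using D_pos(1)[OF assms(1)] D_pos(1)[OF assms(2)] by (simp_all add: radius_D assms)
  then show ?thesis by (simp add: eps2_def centre_def)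
qed

text \<open>
  Only pairs whose centres lie strictly on different sides of \<open>ab w\<close> enter the definition of \<open>eta\<close>.
  They suffice: the interval of \<open>w\<close> has the smallest radius, so an interval whose centre is at most
  \<open>ab w\<close> begins no later than the interval of \<open>w\<close>, and therefore no later than any interval ends,
  because the interval of \<open>w\<close> meets all others. Symmetrically for a centre that is at least \<open>ab w\<close>.
\<close>

lemma intervals_meet:
  fixes e defines "e \<equiv> eta n b w ab aw"
  assumes e: "e \<ge> 0" and k: "k \<in> insert w D" and l: "l \<in> insert w D"
  shows "centre l - radius l * e \<le> centre k + radius k * e"
proof -
  have meets_w: "\<bar>centre i - ab w\<bar> \<le> (radius i + 1) * e" if "i \<in> insert w D" for i
  proof (cases "i = w")
    case False
    with that have i: "i \<in> D" by simp
    have "eps1 w ab aw i * (radius i + radius w) \<le> e * (radius i + radius w)"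
      unfolding e_def using eps1_le_eta[OF i] radius_ge_1[OF that]
      by (intro mult_right_mono) simp_all
    then show ?thesis
      unfolding eps1_mult[OF i] by (simp add: mult.commute)
  qed (use e in simp)
  have radius_e: "e \<le> radius i * e" if "i \<in> insert w D" for i
    using mult_right_mono[OF radius_ge_1[OF that] e] by simp
  consider "centre l \<le> ab w" | "centre k \<ge> ab w" | "centre k < ab w" "centre l > ab w" by linarith
  then show ?thesis
  proof cases
    case 1
    then show ?thesis using meets_w[OF k] radius_e[OF l] by (simp add: algebra_simps)
  next
    case 2
    then show ?thesis using meets_w[OF l] radius_e[OF k] by (simp add: algebra_simps)
  next
    case 3
    then have kl: "k \<in> D" "l \<in> D" using k l by auto
    with 3 have "k \<in> D1 n b w ab aw" "l \<in> D2 n b w ab aw"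
      by (auto simp: D1_def D2_def centre_def)
    from mult_right_mono[OF eps2_le_eta[OF this], of "radius k + radius l"] show ?thesis
      using eps2_mult[OF kl] radius_ge_1[OF k] radius_ge_1[OF l] by (simp add: e_def algebra_simps)
  qed
qed

section \<open>The extremal weights before normalisation\<close>

text \<open>
  For a criterion in \<open>D\<close>, this is the largest weight that has error at most \<open>e\<close> against the weights \<open>\<beta>\<close> of \<open>b\<close>
  and \<open>1\<close> of \<open>w\<close>.
\<close>

definition extremal :: "real \<Rightarrow> real \<Rightarrow> nat \<Rightarrow> real" where
  "extremal e \<beta> i = (if i = b then \<beta> else if i = w then 1 else min (aw i + e) ((\<beta> + e) / ab i))"

lemma extremal_simps [simp]:
  "extremal e \<beta> b = \<beta>" "extremal e \<beta> w = 1"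
  "i \<in> D \<Longrightarrow> extremal e \<beta> i = min (aw i + e) ((\<beta> + e) / ab i)"
  using b_neq_w D_neq by (auto simp: extremal_def)

text \<open>
  By the choice of the minimum the weight of \<open>i\<close> is not too large for either of its two constraints. It is
  not too small because \<open>\<beta>\<close> lies in the interval of \<open>i\<close>: the lower end of this interval is needed when the
  minimum is \<open>(\<beta> + e) / ab i\<close>, the upper end when it is \<open>aw i + e\<close>.
\<close>

lemma extremal_constraints:
  assumes "e \<ge> 0" and \<beta>: "\<And>i. i \<in> insert w D \<Longrightarrow> \<bar>\<beta> - centre i\<bar> \<le> radius i * e"
  shows "i \<in> D \<Longrightarrow> \<bar>\<beta> - ab i * extremal e \<beta> i\<bar> \<le> e"
    and "i \<in> D \<Longrightarrow> \<bar>extremal e \<beta> i - aw i\<bar> \<le> e"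
    and "\<bar>\<beta> - ab w\<bar> \<le> e"
proof -
  show "\<bar>\<beta> - ab w\<bar> \<le> e" using \<beta>[of w] by simp
next
  assume i: "i \<in> D"
  note a = D_pos(1)[OF i]
  have I: "\<bar>\<beta> - ab i * aw i\<bar> \<le> (ab i + 1) * e"
    using \<beta>[of i] i by (simp add: centre_def radius_D)
  show "\<bar>extremal e \<beta> i - aw i\<bar> \<le> e"
  proof -
    have "aw i - e \<le> (\<beta> + e) / ab i"
      using I a by (simp add: field_simps)
    then show ?thesis using i assms(1) by auto
  qed
  have "ab i * extremal e \<beta> i = min (ab i * (aw i + e)) (\<beta> + e)"
    using i a by (simp add: min_mult_distrib_left)
  then show "\<bar>\<beta> - ab i * extremal e \<beta> i\<bar> \<le> e"
    using I assms(1) by (auto simp: algebra_simps min_def)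
qed

text \<open>
  The comparison that proves optimality and uniqueness at once. As the intervals of \<open>k\<close> and \<open>l\<close> touch at
  error \<open>e\<close> when \<open>V w = 1\<close>, they are disjoint unless \<open>V w \<le> \<delta> / e\<close>. All other upper bounds follow from this
  one by monotonicity.
\<close>

lemma scaled_bound:
  assumes e: "e > 0" and k: "k \<in> insert w D" and l: "l \<in> insert w D"
    and upper: "\<beta> = centre k + radius k * e" and lower: "\<beta> = centre l - radius l * e"
    and err: "eps_W n b w ab aw V \<le> \<delta>" and i: "i \<in> {1..n}"
  shows "V i \<le> \<delta> / e * extremal e \<beta> i"
proof -
  define r where "r = \<delta> / e"
  have \<delta>: "\<delta> = r * e" using e by (simp add: r_def)
  have up: "V b \<le> centre k * V w + radius k * \<delta>" and lo: "centre l * V w - radius l * \<delta> \<le> V b"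
    using best_weight_in_interval[OF err k] best_weight_in_interval[OF err l]
    by (simp_all add: abs_le_iff)
  have "(radius k + radius l) * e * V w = (centre l - centre k) * V w"
    using upper lower by (simp add: algebra_simps)
  also have "\<dots> \<le> (radius k + radius l) * e * r"
    using up lo \<delta> by (simp add: algebra_simps)
  finally have w_le: "V w \<le> r"
    using e radius_ge_1[OF k] radius_ge_1[OF l] by (simp add: mult_le_cancel_left)
  have "V b \<le> centre k * r + radius k * \<delta>"
    using up mult_left_mono[OF w_le, of "centre k"] centre_pos[OF k] by linarith
  then have b_le: "V b \<le> r * \<beta>"
    by (simp add: upper \<delta> algebra_simps)
  have "V i \<le> r * extremal e \<beta> i" if iD: "i \<in> D"
  proof -
    have c: "\<bar>V b - ab i * V i\<bar> \<le> r * e" "\<bar>V i - aw i * V w\<bar> \<le> r * e"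
      using err iD by (simp_all add: eps_W_le_iff \<delta>)
    have "V i \<le> r * (aw i + e)"
      using c(2) mult_left_mono[OF w_le, of "aw i"] D_pos(2)[OF iD]
      unfolding abs_le_iff distrib_left mult.commute[of r "aw i"] by linarith
    moreover have "V i \<le> r * ((\<beta> + e) / ab i)"
      using c(1) b_le D_pos(1)[OF iD] by (simp add: field_simps abs_le_iff)
    ultimately show ?thesis using iD by (simp add: min_def)
  qed
  moreover have "i = b \<or> i = w \<or> i \<in> D" using i by (auto simp: D_set_def)
  ultimately show ?thesis using b_le w_le by (auto simp: r_def)
qed

section \<open>Optimality\<close>

text \<open>
  Summing \<open>scaled_bound\<close> over all criteria turns the normalisation \<open>V w = 1\<close> into \<open>\<Sum>V = 1\<close>. The
  resulting bound is attained because \<open>e = eta\<close> puts \<open>\<beta>\<close> into every interval, not just those of \<open>k\<close> and \<open>l\<close>.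
\<close>

theorem optimal_of_touching_intervals:
  fixes e \<beta> :: real
  assumes e: "e > 0" "e = eta n b w ab aw" and k: "k \<in> insert w D" and l: "l \<in> insert w D"
    and upper: "\<beta> = centre k + radius k * e" and lower: "\<beta> = centre l - radius l * e"
  defines "\<sigma> \<equiv> \<Sum>i\<in>{1..n}. extremal e \<beta> i"
  defines "W \<equiv> \<lambda>i\<in>{1..n}. extremal e \<beta> i / \<sigma>"
  shows "is_the_optimal_weight_set n b w ab aw W \<and>
         optimal_value n b w ab aw = eps_W n b w ab aw W \<and>
         eps_W n b w ab aw W = e / \<sigma>"
proof -
  have \<beta>_pos: "\<beta> > 0"
    using upper e(1) centre_pos[OF k] radius_ge_1[OF k] by (simp add: add_pos_pos)
  have ext_pos: "extremal e \<beta> i > 0" if "i \<in> {1..n}" for i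
    using \<beta>_pos e(1) ab_pos[OF that] aw_pos[OF that] by (simp add: extremal_def add_pos_pos)
  have \<sigma>_pos: "\<sigma> > 0"
    unfolding \<sigma>_def using ext_pos b_in by (intro sum_pos) auto
  have sum_W: "(\<Sum>i\<in>{1..n}. W i) = 1"
    using \<sigma>_pos by (simp add: W_def \<sigma>_def flip: sum_divide_distrib)
  have W_in: "W \<in> weight_sets n"
    using sum_W ext_pos \<sigma>_pos by (auto simp: weight_sets_def W_def intro!: less_imp_le divide_pos_pos)
  have \<beta>_in: "\<bar>\<beta> - centre i\<bar> \<le> radius i * e" if "i \<in> insert w D" for i
    using intervals_meet[OF _ k that] intervals_meet[OF _ that l] e upper lower
    by (simp add: abs_le_iff)
  have bound: "V i \<le> eps_W n b w ab aw V / e * extremal e \<beta> i" if "i \<in> {1..n}" for V i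
    using scaled_bound[OF e(1) k l upper lower order_refl that] .
  have lower_bound: "e / \<sigma> \<le> eps_W n b w ab aw V" if "V \<in> weight_sets n" for V
  proof -
    have "1 \<le> (\<Sum>i\<in>{1..n}. eps_W n b w ab aw V / e * extremal e \<beta> i)"
      using that sum_mono[of "{1..n}" V, OF bound[of _ V]] by (simp add: weight_sets_def)
    also have "\<dots> = eps_W n b w ab aw V / e * \<sigma>"
      by (simp add: \<sigma>_def sum_distrib_left)
    finally show ?thesis
      using e(1) \<sigma>_pos by (simp add: field_simps)
  qed
  have "eps_W n b w ab aw W \<le> e / \<sigma>"
  proof -
    have scale: "\<bar>x / \<sigma> - a * (y / \<sigma>)\<bar> \<le> e / \<sigma>" if "\<bar>x - a * y\<bar> \<le> e" for x y a
    proof -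
      have "\<bar>x / \<sigma> - a * (y / \<sigma>)\<bar> = \<bar>x - a * y\<bar> / \<sigma>"
        using \<sigma>_pos by (simp add: abs_divide flip: diff_divide_distrib)
      then show ?thesis using that \<sigma>_pos by (simp add: divide_right_mono)
    qed
    have W_at: "i \<in> {1..n} \<Longrightarrow> W i = extremal e \<beta> i / \<sigma>" for i
      by (simp add: W_def)
    note c = extremal_constraints[OF less_imp_le[OF e(1)] \<beta>_in]
    show ?thesis
      unfolding eps_W_le_iff
    proof (intro conjI ballI)
      fix i assume i: "i \<in> D"
      then have i': "i \<in> {1..n}" by (simp add: D_set_def)
      show "\<bar>W b - ab i * W i\<bar> \<le> e / \<sigma>"
        unfolding W_at[OF b_in] W_at[OF i'] by (rule scale) (use c(1)[OF _ i] in simp)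
      show "\<bar>W i - aw i * W w\<bar> \<le> e / \<sigma>"
        unfolding W_at[OF w_in] W_at[OF i'] by (rule scale) (use c(2)[OF _ i] in simp)
    next
      show "\<bar>W b - ab w * W w\<bar> \<le> e / \<sigma>"
        unfolding W_at[OF b_in] W_at[OF w_in] by (rule scale) (use c(3) in simp)
    qed
  qed
  with lower_bound[OF W_in] have eps: "eps_W n b w ab aw W = e / \<sigma>" by simp
  have min_W: "is_minimizer n b w ab aw W"
    using W_in lower_bound by (simp add: is_minimizer_def eps)
  have "V = W" if V: "is_minimizer n b w ab aw V" for V
  proof -
    have V_in: "V \<in> weight_sets n" using V by (simp add: is_minimizer_def)
    have "eps_W n b w ab aw V \<le> e / \<sigma>"
      using V W_in unfolding is_minimizer_def eps[symmetric] by blast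
    with lower_bound[OF V_in] have "eps_W n b w ab aw V = e / \<sigma>" by simp
    then have le: "V i \<le> W i" if "i \<in> {1..n}" for i
      using bound[OF that, of V] e(1) that by (simp add: W_def)
    \<comment> \<open>Both families sum to 1, so no inequality can be strict.\<close>
    have eq: "V i = W i" if i: "i \<in> {1..n}" for i
    proof (rule ccontr)
      assume "V i \<noteq> W i"
      with le[OF i] have "V i < W i" by simp
      with le i have "sum V {1..n} < sum W {1..n}"
        by (intro sum_strict_mono_ex1) auto
      with sum_W V_in show False by (simp add: weight_sets_def)
    qed
    have "V \<in> {1..n} \<rightarrow>\<^sub>E UNIV" "W \<in> {1..n} \<rightarrow>\<^sub>E UNIV"
      using V_in W_in by (simp_all add: weight_sets_def)
    then show ?thesis using eq by (rule PiE_ext)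
  qed
  with min_W have "is_the_optimal_weight_set n b w ab aw W"
    unfolding is_the_optimal_weight_set_def by blast
  with optimal_value_eq_eps_W[OF min_W] eps show ?thesis by blast
qed

corollary optimal_of_eq_extremal:
  assumes "e > 0" "e = eta n b w ab aw" "k \<in> insert w D" "l \<in> insert w D"
    and "\<beta> = centre k + radius k * e" "\<beta> = centre l - radius l * e"
    and \<sigma>: "(\<Sum>i\<in>{1..n}. extremal e \<beta> i) = \<sigma>"
    and f: "\<And>i. i \<in> {1..n} \<Longrightarrow> f i = extremal e \<beta> i / \<sigma>"
  shows "is_the_optimal_weight_set n b w ab aw (restrict f {1..n}) \<and>
         optimal_value n b w ab aw = eps_W n b w ab aw (restrict f {1..n}) \<and>
         eps_W n b w ab aw (restrict f {1..n}) = e / \<sigma>"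
proof -
  have "restrict f {1..n} = (\<lambda>i\<in>{1..n}. extremal e \<beta> i / \<sigma>)"
    using f by (rule restrict_ext)
  then show ?thesis
    using optimal_of_touching_intervals[OF assms(1-6)] \<sigma> by simp
qed

lemma sum_extremal:
  "(\<Sum>i\<in>{1..n}. extremal e \<beta> i) = 1 + \<beta> + (\<Sum>i\<in>D. min (aw i + e) ((\<beta> + e) / ab i))"
proof -
  have "{1..n} = insert b (insert w D)"
    using b_in w_in by (auto simp: D_set_def)
  moreover have "b \<notin> D" "w \<notin> D"
    using D_neq by blast+
  ultimately show ?thesis
    using b_neq_w by simp
qed

text \<open>
  The minimum can be evaluated for a criterion whose interval ends in \<open>\<beta>\<close>. This is where the exceptional
  formulas for the weights of \<open>i0\<close> and \<open>j0\<close> come from: they are the general one for these criteria.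
\<close>

lemma extremal_upper_end:
  assumes "i \<in> D" "e \<ge> 0" "\<beta> = centre i + radius i * e"
  shows "min (aw i + e) ((\<beta> + e) / ab i) = aw i + e"
  using D_pos(1)[OF assms(1)] assms by (simp add: centre_def radius_D field_simps)

lemma extremal_lower_end:
  assumes "i \<in> D" "e \<ge> 0" "\<beta> = centre i - radius i * e"
  shows "min (aw i + e) ((\<beta> + e) / ab i) = aw i - e"
proof -
  have "(\<beta> + e) / ab i = aw i - e"
    using D_pos(1)[OF assms(1)] assms by (simp add: centre_def radius_D field_simps)
  with assms(2) show ?thesis by simp
qed

lemma touching_error_pos:
  assumes "e * (radius i + radius j) = d" "d > 0" "i \<in> insert w D" "j \<in> insert w D"
  shows "e > 0"
proof -
  have "radius i + radius j > 0"
    using radius_ge_1[OF assms(3)] radius_ge_1[OF assms(4)] by linarith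
  then show ?thesis
    using assms(1,2) zero_less_mult_pos2 by blast
qed

end

section \<open>The three cases\<close>

theorem theorem2:
  fixes n b w :: nat and ab aw :: "nat \<Rightarrow> real"
  assumes "pcs n b w ab aw"
  shows
    "(\<forall>i0\<in>D1 n b w ab aw. eta n b w ab aw = eps1 w ab aw i0 \<longrightarrow>
       (let e = eps1 w ab aw i0;
            m = (\<lambda>i. min (aw i + e) (ab w / ab i));
            \<sigma> = 1 + ab w + aw i0 + (\<Sum>i\<in>D_set n b w - {i0}. m i);
            W = (\<lambda>i\<in>{1..n}. if i = b then (ab w - e) / \<sigma>
                             else if i = i0 then (aw i0 + e) / \<sigma>
                             else if i = w then 1 / \<sigma>
                             else m i / \<sigma>)
        in is_the_optimal_weight_set n b w ab aw W \<and>
           optimal_value n b w ab aw = eps_W n b w ab aw W \<and>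
           eps_W n b w ab aw W = e / \<sigma>))
   \<and> (\<forall>j0\<in>D2 n b w ab aw. eta n b w ab aw = eps1 w ab aw j0 \<longrightarrow>
       (let e = eps1 w ab aw j0;
            m = (\<lambda>i. min (aw i + e) ((ab w + 2 * e) / ab i));
            \<sigma> = 1 + ab w + aw j0 + (\<Sum>i\<in>D_set n b w - {j0}. m i);
            W = (\<lambda>i\<in>{1..n}. if i = b then (ab w + e) / \<sigma>
                             else if i = j0 then (aw j0 - e) / \<sigma>
                             else if i = w then 1 / \<sigma>
                             else m i / \<sigma>)
        in is_the_optimal_weight_set n b w ab aw W \<and>
           optimal_value n b w ab aw = eps_W n b w ab aw W \<and>
           eps_W n b w ab aw W = e / \<sigma>))
   \<and> (\<forall>i0\<in>D1 n b w ab aw. \<forall>j0\<in>D2 n b w ab aw. eta n b w ab aw = eps2 ab aw i0 j0 \<longrightarrow>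
       (let e = eps2 ab aw i0 j0;
            m = (\<lambda>i. min (aw i + e) ((ab i0 * aw i0 + (ab i0 + 2) * e) / ab i));
            \<sigma> = 1 + aw i0 + aw j0 + ab i0 * aw i0 + (ab i0 + 1) * e
                  + (\<Sum>i\<in>D_set n b w - {i0, j0}. m i);
            W = (\<lambda>i\<in>{1..n}. if i = b then (ab i0 * aw i0 + (ab i0 + 1) * e) / \<sigma>
                             else if i = i0 then (aw i0 + e) / \<sigma>
                             else if i = j0 then (aw j0 - e) / \<sigma>
                             else if i = w then 1 / \<sigma>
                             else m i / \<sigma>)
        in is_the_optimal_weight_set n b w ab aw W \<and>
           optimal_value n b w ab aw = eps_W n b w ab aw W \<and>
           eps_W n b w ab aw W = e / \<sigma>))"
proof -
  interpret best_worst n b w ab aw by unfold_locales (fact assms)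
  show ?thesis
  proof (intro conjI ballI impI, goal_cases)
    case (1 i0)
    define e where "e = eps1 w ab aw i0"
    define \<beta> where "\<beta> = ab w - e"
    have D: "i0 \<in> D" and less: "centre i0 < centre w"
      using 1 by (auto simp: D1_def centre_def)
    have mult: "e * (radius i0 + radius w) = centre w - centre i0"
      using eps1_mult[OF D] less by (simp add: e_def)
    have eta: "e = eta n b w ab aw" and k: "i0 \<in> insert w D" and l: "w \<in> insert w D"
      using 1 D by (simp_all add: e_def)
    have pos: "e > 0"
      using touching_error_pos[OF mult] less D by simp
    have upper: "\<beta> = centre i0 + radius i0 * e" and lower: "\<beta> = centre w - radius w * e"
      using mult by (simp_all add: \<beta>_def algebra_simps)
    have \<beta>_e: "\<beta> + e = ab w" by (simp add: \<beta>_def)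
    note x_i0 = extremal_upper_end[OF D less_imp_le[OF pos] upper, unfolded \<beta>_e]
    have X: "extremal e \<beta> i = (if i = b then ab w - e else if i = i0 then aw i0 + e
        else if i = w then 1 else min (aw i + e) (ab w / ab i))" for i
      using D_neq[OF D] x_i0 unfolding extremal_def \<beta>_e by (simp add: \<beta>_def)
    show ?case
      unfolding Let_def e_def[symmetric]
    proof (rule optimal_of_eq_extremal[OF pos eta k l upper lower])
      show "(\<Sum>i\<in>{1..n}. extremal e \<beta> i) =
          1 + ab w + aw i0 + (\<Sum>i\<in>D - {i0}. min (aw i + e) (ab w / ab i))"
        unfolding sum_extremal \<beta>_e sum.remove[OF finite_D_set D] x_i0 by (simp add: \<beta>_def)
    qed (simp add: X)
  next
    case (2 j0)
    define e where "e = eps1 w ab aw j0"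
    define \<beta> where "\<beta> = ab w + e"
    have D: "j0 \<in> D" and less: "centre w < centre j0"
      using 2 by (auto simp: D2_def centre_def)
    have mult: "e * (radius j0 + radius w) = centre j0 - centre w"
      using eps1_mult[OF D] less by (simp add: e_def)
    have eta: "e = eta n b w ab aw" and k: "w \<in> insert w D" and l: "j0 \<in> insert w D"
      using 2 D by (simp_all add: e_def)
    have pos: "e > 0"
      using touching_error_pos[OF mult] less D by simp
    have upper: "\<beta> = centre w + radius w * e" and lower: "\<beta> = centre j0 - radius j0 * e"
      using mult by (simp_all add: \<beta>_def algebra_simps)
    have \<beta>_e: "\<beta> + e = ab w + 2 * e" by (simp add: \<beta>_def)
    note x_j0 = extremal_lower_end[OF D less_imp_le[OF pos] lower, unfolded \<beta>_e]
    have X: "extremal e \<beta> i = (if i = b then ab w + e else if i = j0 then aw j0 - e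
        else if i = w then 1 else min (aw i + e) ((ab w + 2 * e) / ab i))" for i
      using D_neq[OF D] x_j0 unfolding extremal_def \<beta>_e by (simp add: \<beta>_def)
    show ?case
      unfolding Let_def e_def[symmetric]
    proof (rule optimal_of_eq_extremal[OF pos eta k l upper lower])
      show "(\<Sum>i\<in>{1..n}. extremal e \<beta> i) =
          1 + ab w + aw j0 + (\<Sum>i\<in>D - {j0}. min (aw i + e) ((ab w + 2 * e) / ab i))"
        unfolding sum_extremal \<beta>_e sum.remove[OF finite_D_set D] x_j0 by (simp add: \<beta>_def)
    qed (simp add: X)
  next
    case (3 i0 j0)
    define e where "e = eps2 ab aw i0 j0"
    define \<beta> where "\<beta> = ab i0 * aw i0 + (ab i0 + 1) * e"
    have D: "i0 \<in> D" "j0 \<in> D" and less: "centre i0 < centre j0"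
      using 3 by (auto simp: D1_def D2_def centre_def)
    then have neq: "i0 \<noteq> j0" by auto
    have mult: "e * (radius i0 + radius j0) = centre j0 - centre i0"
      using eps2_mult[OF D] less by (simp add: e_def)
    have eta: "e = eta n b w ab aw" and k: "i0 \<in> insert w D" and l: "j0 \<in> insert w D"
      using 3 D by (simp_all add: e_def)
    have pos: "e > 0"
      using touching_error_pos[OF mult] less D by simp
    have upper: "\<beta> = centre i0 + radius i0 * e"
      using D by (simp add: \<beta>_def centre_def radius_D)
    then have lower: "\<beta> = centre j0 - radius j0 * e"
      using mult by (simp add: algebra_simps)
    have \<beta>_e: "\<beta> + e = ab i0 * aw i0 + (ab i0 + 2) * e" by (simp add: \<beta>_def algebra_simps)
    note x_i0 = extremal_upper_end[OF D(1) less_imp_le[OF pos] upper, unfolded \<beta>_e]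
      and x_j0 = extremal_lower_end[OF D(2) less_imp_le[OF pos] lower, unfolded \<beta>_e]
    have X: "extremal e \<beta> i = (if i = b then ab i0 * aw i0 + (ab i0 + 1) * e
        else if i = i0 then aw i0 + e else if i = j0 then aw j0 - e
        else if i = w then 1 else min (aw i + e) ((ab i0 * aw i0 + (ab i0 + 2) * e) / ab i))" for i
      using D_neq[OF D(1)] D_neq[OF D(2)] neq x_i0 x_j0
      unfolding extremal_def \<beta>_e by (simp add: \<beta>_def)
    show ?case
      unfolding Let_def e_def[symmetric]
    proof (rule optimal_of_eq_extremal[OF pos eta k l upper lower])
      have D_eq: "D = insert i0 (insert j0 (D - {i0, j0}))" using D by auto
      have "(\<Sum>i\<in>D. f i) = f i0 + f j0 + (\<Sum>i\<in>D - {i0, j0}. f i)" for f :: "nat \<Rightarrow> real"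
        using neq by (subst D_eq) (simp add: add.assoc)
      then show "(\<Sum>i\<in>{1..n}. extremal e \<beta> i) =
          1 + aw i0 + aw j0 + ab i0 * aw i0 + (ab i0 + 1) * e +
          (\<Sum>i\<in>D - {i0, j0}. min (aw i + e) ((ab i0 * aw i0 + (ab i0 + 2) * e) / ab i))"
        unfolding sum_extremal \<beta>_e using x_i0 x_j0 by (simp add: \<beta>_def)
    qed (simp add: X)
  qed
qed

end
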